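(* Let $P=(P,\leq_h,\leq_r)$ be a double poset. 1. (a) If $P$ is $h$-connected, then it is $1$-indecomposable. (b) If $P$ is plane and $1$-indecomposable, then it is $h$-connected. 2. (a) If $P$ is $r$-connected, then it is $2$-indecomposable. (b) If $P$ is plane and $2$-indecomposable, then it is $r$-connected.
   Context: A double poset is a triple $(P,\leq_1,\leq_2)$ where $P$ is a finite set and $\leq_1,\leq_2$ are two partial orders on $P$; here they are denoted $\leq_h=\leq_1$ and $\leq_r=\leq_2$. It is plane if for all $x,y\in P$ with $x\neq y$, $x$ and $y$ are comparable for $\leq_h$ if and only if they are not comparable for $\leq_r$. For a poset $(P,\preceq)$, define an equivalence relation on $P$ by declaring $x$ and $y$ equivalent if there are elements $x=x_0,x_1,\ldots,x_n=y$ of $P$ such that $x_i$ and $x_{i+1}$ are comparable for $\preceq$ for all $i\in\{0,\ldots,n-1\}$. The equivalence classes are the connected components of the poset, and the poset is connected if it has only one connected component; by convention, $\emptyset$ is not considered as connected. The double poset $P$ is $h$-connected if $(P,\leq_h)$ is connected, and $r$-connected if $(P,\leq_r)$ is connected. $P$ is $1$-indecomposable if for any $I\subseteq P$: (for all $x\in I$ and all $y\in P\setminus I$, $x\leq_r y$ and $x,y$ are not $\leq_h$-comparable) if and only if ($I=\emptyset$ or $I=P$). $P$ is $2$-indecomposable if for any $I\subseteq P$: (for all $x\in I$ and all $y\in P\setminus I$, $x\leq_h y$ and $x,y$ are not $\leq_r$-comparable) if and only if ($I=\emptyset$ or $I=P$).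
   Formalization: In 1(b) and 2(b), P is additionally assumed nonempty, since the empty double poset is plane and both 1- and 2-indecomposable but by convention not connected. *)

theory Defs
  imports Main
begin

definition double_poset :: "'a set \<Rightarrow> 'a rel \<Rightarrow> 'a rel \<Rightarrow> bool" where
  "double_poset P h r \<longleftrightarrow> finite P \<and> partial_order_on P h \<and> partial_order_on P r"

definition comparable :: "'a rel \<Rightarrow> 'a \<Rightarrow> 'a \<Rightarrow> bool" where
  "comparable le x y \<longleftrightarrow> (x, y) \<in> le \<or> (y, x) \<in> le"

definition plane :: "'a set \<Rightarrow> 'a rel \<Rightarrow> 'a rel \<Rightarrow> bool" where
  "plane P h r \<longleftrightarrow>
    (\<forall>x\<in>P. \<forall>y\<in>P. x \<noteq> y \<longrightarrow> (comparable h x y \<longleftrightarrow> \<not> comparable r x y))"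

definition linked :: "'a set \<Rightarrow> 'a rel \<Rightarrow> 'a rel" where
  "linked P le =
    {(x, y). x \<in> P \<and> y \<in> P \<and> (x, y) \<in> {(u, v). u \<in> P \<and> v \<in> P \<and> comparable le u v}\<^sup>*}"

definition connected_components :: "'a set \<Rightarrow> 'a rel \<Rightarrow> 'a set set" where
  "connected_components P le = P // linked P le"

text \<open>The empty poset has no connected component, hence is not connected.\<close>

definition poset_connected :: "'a set \<Rightarrow> 'a rel \<Rightarrow> bool" where
  "poset_connected P le \<longleftrightarrow> (\<exists>!C. C \<in> connected_components P le)"

definition h_connected :: "'a set \<Rightarrow> 'a rel \<Rightarrow> 'a rel \<Rightarrow> bool" where
  "h_connected P h r \<longleftrightarrow> poset_connected P h"

definition r_connected :: "'a set \<Rightarrow> 'a rel \<Rightarrow> 'a rel \<Rightarrow> bool" where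
  "r_connected P h r \<longleftrightarrow> poset_connected P r"

definition one_indecomposable :: "'a set \<Rightarrow> 'a rel \<Rightarrow> 'a rel \<Rightarrow> bool" where
  "one_indecomposable P h r \<longleftrightarrow>
    (\<forall>I. I \<subseteq> P \<longrightarrow>
      ((\<forall>x\<in>I. \<forall>y\<in>P - I. (x, y) \<in> r \<and> \<not> comparable h x y) \<longleftrightarrow> I = {} \<or> I = P))"

definition two_indecomposable :: "'a set \<Rightarrow> 'a rel \<Rightarrow> 'a rel \<Rightarrow> bool" where
  "two_indecomposable P h r \<longleftrightarrow>
    (\<forall>I. I \<subseteq> P \<longrightarrow>
      ((\<forall>x\<in>I. \<forall>y\<in>P - I. (x, y) \<in> h \<and> \<not> comparable r x y) \<longleftrightarrow> I = {} \<or> I = P))"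

text \<open>The empty double poset is plane and indecomposable in both senses, but not connected:
  implications from indecomposability to connectedness need a nonempty poset.\<close>

lemma empty_double_poset:
  "double_poset {} {} {}" "plane {} {} {}"
  "one_indecomposable {} {} {}" "two_indecomposable {} {} {}"
  "\<not> h_connected {} {} {}" "\<not> r_connected {} {} {}"
  by (auto simp: double_poset_def plane_def one_indecomposable_def two_indecomposable_def
      h_connected_def r_connected_def poset_connected_def connected_components_def)

lemma equiv_linked: "equiv P (linked P le)"
proof (rule equivI)
  show "linked P le \<subseteq> P \<times> P"
    by (auto simp: linked_def)
  show "refl_on P (linked P le)"
    by (auto simp: linked_def refl_on_def)
  have "sym {(u, v). u \<in> P \<and> v \<in> P \<and> comparable le u v}"
    by (auto simp: sym_def comparable_def)
  from sym_rtrancl[OF this] show "sym (linked P le)"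
    by (auto simp: linked_def sym_def)
  show "trans (linked P le)"
    by (auto simp: linked_def intro!: transI intro: rtrancl_trans)
qed

end

theory Submission
  imports Defs
begin

text \<open>The two parts of the theorem are exchanged by swapping the two orders, so it suffices to
  treat the first one.

  A path of \<open>h\<close>-comparabilities cannot leave a set \<open>I\<close> none of whose elements is \<open>h\<close>-comparable to
  an element outside. Hence in an \<open>h\<close>-connected poset such a set is trivial.

  Conversely, in a plane double poset any two elements of distinct \<open>h\<close>-components are
  \<open>r\<close>-comparable, and the \<open>r\<close>-order between an element \<open>y\<close> and an \<open>h\<close>-component not containing it
  is the same for all elements of that component: if \<open>y\<close> were \<open>r\<close>-between two \<open>h\<close>-comparable
  elements, these would be \<open>r\<close>-comparable too, contradicting planarity. So the component of an
  \<open>r\<close>-minimal element of \<open>P\<close> lies \<open>r\<close>-below everything outside it. By \<open>1\<close>-indecomposability it is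
  the whole of \<open>P\<close>.\<close>

lemma linked_refl: "x \<in> P \<Longrightarrow> (x, x) \<in> linked P le"
  by (simp add: linked_def)

lemma linked_step:
  assumes "(x, y) \<in> linked P le" "z \<in> P" "comparable le y z"
  shows "(x, z) \<in> linked P le"
  using assms by (auto simp: linked_def intro: rtrancl_into_rtrancl)

lemma linked_induct [consumes 1, case_names refl step]:
  assumes "(x, y) \<in> linked P le"
    and "Q x"
    and "\<And>u v. (x, u) \<in> linked P le \<Longrightarrow> v \<in> P \<Longrightarrow> comparable le u v \<Longrightarrow> Q u \<Longrightarrow> Q v"
  shows "Q y"
proof -
  let ?R = "{(u, v). u \<in> P \<and> v \<in> P \<and> comparable le u v}"
  from assms(1) have "x \<in> P" and "(x, y) \<in> ?R\<^sup>*"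
    by (auto simp: linked_def)
  from this(2) show ?thesis
  proof (induction rule: rtrancl_induct)
    case base
    show ?case by (fact assms(2))
  next
    case (step u v)
    from step.hyps \<open>x \<in> P\<close> have "(x, u) \<in> linked P le"
      by (auto simp: linked_def)
    with step show ?case by (auto intro: assms(3))
  qed
qed

text \<open>Counting equivalence classes is replaced by the condition on pairs of elements that the
  arguments below work with.\<close>

lemma poset_connected_iff:
  "poset_connected P le \<longleftrightarrow> P \<noteq> {} \<and> (\<forall>x\<in>P. \<forall>y\<in>P. (x, y) \<in> linked P le)"
proof
  assume "poset_connected P le"
  then obtain C where C: "C \<in> P // linked P le"
    and unique: "\<And>D. D \<in> P // linked P le \<Longrightarrow> D = C"
    unfolding poset_connected_def connected_components_def by blast
  from C have "P \<noteq> {}"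
    by (auto simp: quotient_def)
  moreover have "(x, y) \<in> linked P le" if "x \<in> P" "y \<in> P" for x y
  proof -
    from that have "linked P le `` {x} = linked P le `` {y}"
      using unique quotientI by metis
    with \<open>y \<in> P\<close> show ?thesis
      using linked_refl by fastforce
  qed
  ultimately show "P \<noteq> {} \<and> (\<forall>x\<in>P. \<forall>y\<in>P. (x, y) \<in> linked P le)"
    by blast
next
  assume *: "P \<noteq> {} \<and> (\<forall>x\<in>P. \<forall>y\<in>P. (x, y) \<in> linked P le)"
  then have "linked P le `` {x} = P" if "x \<in> P" for x
    using that by (auto simp: linked_def)
  with * have "P // linked P le = {P}"
    by (auto simp: quotient_def)
  then show "poset_connected P le"
    by (simp add: poset_connected_def connected_components_def)
qed

text \<open>A path of comparabilities starting in \<open>I\<close> never makes its first step out of \<open>I\<close>.\<close>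

lemma connected_no_separation:
  assumes "poset_connected P le" "I \<subseteq> P" "I \<noteq> {}"
    and separated: "\<And>x y. x \<in> I \<Longrightarrow> y \<in> P - I \<Longrightarrow> \<not> comparable le x y"
  shows "I = P"
proof -
  from \<open>I \<noteq> {}\<close> obtain x where "x \<in> I" by blast
  have "y \<in> I" if "y \<in> P" for y
  proof -
    from assms(1,2) \<open>x \<in> I\<close> \<open>y \<in> P\<close> have "(x, y) \<in> linked P le"
      by (auto simp: poset_connected_iff)
    then show ?thesis
    proof (induction rule: linked_induct)
      case refl
      show ?case by (fact \<open>x \<in> I\<close>)
    next
      case (step u v)
      then show ?case using separated by blast
    qed
  qed
  with \<open>I \<subseteq> P\<close> show ?thesis by blast
qed

lemma connected_imp_one_indecomposable:
  assumes "poset_connected P h"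
  shows "one_indecomposable P h r"
  unfolding one_indecomposable_def
  using connected_no_separation[OF assms] by blast

text \<open>The relation \<open>x \<le>\<^sub>r y\<close> propagates along \<open>h\<close>-paths that stay away from \<open>y\<close>. If it broke between
  \<open>h\<close>-comparable elements \<open>u\<close> and \<open>v\<close>, then \<open>u \<le>\<^sub>r y \<le>\<^sub>r v\<close> would make these comparable for both
  orders.\<close>

lemma plane_below_component:
  assumes "plane P h r" "trans r"
    and "(x, x') \<in> linked P h"
    and y: "y \<in> P" "(x, y) \<notin> linked P h"
    and "(x, y) \<in> r"
  shows "(x', y) \<in> r"
  using assms(3)
proof (induction rule: linked_induct)
  case refl
  show ?case by (fact \<open>(x, y) \<in> r\<close>)
next
  case (step u v)
  from step.hyps(1) have "u \<in> P"
    by (simp add: linked_def)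
  from step.hyps have v: "(x, v) \<in> linked P h"
    by (rule linked_step)
  with y have "v \<noteq> y" and "\<not> comparable h v y"
    using linked_step by fastforce+
  with \<open>plane P h r\<close> \<open>v \<in> P\<close> y(1) have "comparable r v y"
    by (auto simp: plane_def)
  moreover have "(v, y) \<in> r" if "(y, v) \<in> r"
  proof (cases "u = v")
    case True
    with step.IH show ?thesis by simp
  next
    case False
    from \<open>trans r\<close> step.IH that have "comparable r u v"
      by (auto simp: comparable_def dest: transD)
    with False \<open>plane P h r\<close> \<open>u \<in> P\<close> \<open>v \<in> P\<close> \<open>comparable h u v\<close> show ?thesis
      by (auto simp: plane_def)
  qed
  ultimately show ?case
    by (auto simp: comparable_def)
qed

lemma partial_order_on_finite_minimal:
  assumes "finite P" "P \<noteq> {}" "partial_order_on P r"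
  obtains m where "m \<in> P" "\<And>y. y \<in> P \<Longrightarrow> (y, m) \<in> r \<Longrightarrow> y = m"
proof -
  let ?less = "\<lambda>x y. (x, y) \<in> r \<and> x \<noteq> y"
  from assms(3) have "antisym r" "trans r"
    by (auto simp: partial_order_on_def preorder_on_def)
  then have "asymp_on P ?less" "transp_on P ?less"
    by (auto intro!: asymp_onI transp_onI dest: antisymD transD)
  then show ?thesis
    using that Finite_Set.bex_min_element[of P ?less] assms(1,2) by blast
qed

lemma plane_one_indecomposable_imp_connected:
  assumes "double_poset P h r" "P \<noteq> {}" "plane P h r" "one_indecomposable P h r"
  shows "poset_connected P h"
proof -
  from assms(1) have "finite P" and po: "partial_order_on P r"
    by (auto simp: double_poset_def)
  then have "trans r"
    by (simp add: partial_order_on_def preorder_on_def)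
  obtain m where "m \<in> P" and minimal: "\<And>y. y \<in> P \<Longrightarrow> (y, m) \<in> r \<Longrightarrow> y = m"
    using partial_order_on_finite_minimal[OF \<open>finite P\<close> \<open>P \<noteq> {}\<close> po] by blast
  define C where "C = linked P h `` {m}"
  have "m \<in> C" and "C \<subseteq> P"
    using \<open>m \<in> P\<close> by (auto simp: C_def linked_def)
  have "(x, y) \<in> r \<and> \<not> comparable h x y" if "x \<in> C" "y \<in> P - C" for x y
  proof
    have not_linked: "(m, y) \<notin> linked P h" and "y \<in> P"
      using that by (auto simp: C_def)
    with \<open>m \<in> P\<close> have "m \<noteq> y" "\<not> comparable h m y"
      using linked_refl linked_step by fastforce+
    with \<open>plane P h r\<close> \<open>m \<in> P\<close> \<open>y \<in> P\<close> minimal have "(m, y) \<in> r"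
      by (auto simp: plane_def comparable_def)
    with \<open>x \<in> C\<close> show "(x, y) \<in> r"
      using plane_below_component[OF \<open>plane P h r\<close> \<open>trans r\<close> _ \<open>y \<in> P\<close> not_linked]
      by (simp add: C_def)
    show "\<not> comparable h x y"
      using \<open>x \<in> C\<close> not_linked \<open>y \<in> P\<close> linked_step by (fastforce simp: C_def)
  qed
  with assms(4) \<open>C \<subseteq> P\<close> have "C = {} \<or> C = P"
    unfolding one_indecomposable_def by blast
  with \<open>m \<in> C\<close> have "C = P" by blast
  then have from_m: "(m, x) \<in> linked P h" if "x \<in> P" for x
    using that by (auto simp: C_def)
  have "(x, y) \<in> linked P h" if "x \<in> P" "y \<in> P" for x y
    using from_m[OF that(1)] from_m[OF that(2)] equiv_linked[of P h]
    by (meson equivE symD transD)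
  with \<open>P \<noteq> {}\<close> show ?thesis
    by (simp add: poset_connected_iff)
qed

lemma double_poset_swap: "double_poset P h r \<longleftrightarrow> double_poset P r h"
  by (auto simp: double_poset_def)

lemma plane_swap: "plane P h r \<longleftrightarrow> plane P r h"
  by (auto simp: plane_def)

lemma two_indecomposable_swap: "two_indecomposable P h r \<longleftrightarrow> one_indecomposable P r h"
  by (simp add: two_indecomposable_def one_indecomposable_def)

theorem proposition19:
  fixes P :: "'a set" and h r :: "'a rel"
  assumes "double_poset P h r"
  shows "(h_connected P h r \<longrightarrow> one_indecomposable P h r) \<and>
    (P \<noteq> {} \<and> plane P h r \<and> one_indecomposable P h r \<longrightarrow> h_connected P h r) \<and>
    (r_connected P h r \<longrightarrow> two_indecomposable P h r) \<and>
    (P \<noteq> {} \<and> plane P h r \<and> two_indecomposable P h r \<longrightarrow> r_connected P h r)"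
  unfolding h_connected_def r_connected_def two_indecomposable_swap
  using assms double_poset_swap plane_swap connected_imp_one_indecomposable
    plane_one_indecomposable_imp_connected by metis

end
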